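(* Let $\Sigma_{\mathcal P}\sim(A,B,C,D)$ be a poset-causal system with dual system $\Sigma_{\mathcal P_d}\sim(A^\intercal,C^\intercal,B^\intercal,D^\intercal)$. Let $\overline{\mathcal R},\mathcal R^\circ,\widetilde{\mathcal R},\overline{\mathcal N},\mathcal N^\circ,\widetilde{\mathcal N}$ be the structured subspaces associated with $\Sigma_{\mathcal P}$, and let $(\overline{\mathcal R})^d,(\mathcal R^\circ)^d,(\widetilde{\mathcal R})^d,(\overline{\mathcal N})^d,(\mathcal N^\circ)^d,(\widetilde{\mathcal N})^d$ be the corresponding subspaces associated with $\Sigma_{\mathcal P_d}$. Then $$(\overline{\mathcal R})^d=\widetilde{\mathcal N}^\perp,\quad(\mathcal R^\circ)^d=(\mathcal N^\circ)^\perp,\quad(\widetilde{\mathcal R})^d=\overline{\mathcal N}^\perp,\quad(\overline{\mathcal N})^d=\widetilde{\mathcal R}^\perp,\quad(\mathcal N^\circ)^d=(\mathcal R^\circ)^\perp,\quad(\widetilde{\mathcal N})^d=\overline{\mathcal R}^\perp.$$ In particular, the following equivalences hold: (i) $\Sigma_{\mathcal P}$ is weakly upstream controllable if and only if $\Sigma_{\mathcal P_d}$ is weakly downstream observable; (ii) $\Sigma_{\mathcal P}$ is weakly locally controllable if and only if $\Sigma_{\mathcal P_d}$ is weakly locally observable.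
   Context: Let $\mathcal P=(P,\succeq)$ be a partially ordered set with $P=\{1,\dots,p\}$. For $i\in P$ put ${\downarrow}i=\{j\in P: i\succeq j\}$ and ${\uparrow}i=\{j\in P: j\succeq i\}$. The dual poset is $\mathcal P_d=(P,\succeq_d)$ with $j\succeq_d i$ iff $i\succeq j$. A partition is a tuple $\underline n=(n_1,\dots,n_p)$ of nonnegative integers. $\mathcal I_{\mathcal P}^{\underline n\times\underline m}$ is the space of real block matrices $G=[G_{ij}]_{i,j=1}^p$ with $G_{ij}\in\mathbb R^{n_i\times m_j}$ and $G_{ij}=0$ whenever $j\not\succeq i$. For $R,S\subseteq P$, $G(R,S)$ is the block submatrix of $G$ with block rows indexed by $R$ and block columns indexed by $S$ (a singleton $\{i\}$ is written $i$). A poset-causal system $\Sigma_{\mathcal P}\sim(A,B,C,D)$ is the linear system $\dot x=Ax+Bu$, $y=Cx+Du$ with $A\in\mathcal I_{\mathcal P}^{\underline n\times\underline n}$, $B\in\mathcal I_{\mathcal P}^{\underline n\times\underline m}$, $C\in\mathcal I_{\mathcal P}^{\underline r\times\underline n}$, $D\in\mathcal I_{\mathcal P}^{\underline r\times\underline m}$. Its dual system $\Sigma_{\mathcal P_d}\sim(A^\intercal,C^\intercal,B^\intercal,D^\intercal)$ is poset-causal with underlying poset $\mathcal P_d$ and has the same local state spaces. Local state spaces are $\mathcal X_i=\mathbb R^{n_i}$, and $\mathcal X=\bigoplus_{i\in P}\mathcal X_i$ (orthogonal direct sum); for $S\subseteq P$, $\mathcal X_S=\bigoplus_{j\in S}\mathcal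 X_j\subseteq\mathcal X$. $P_{\mathcal X_i}$ is the orthogonal projection onto $\mathcal X_i$; $\perp$ is the orthogonal complement in $\mathcal X$. For $A$ of size $N\times N$, $\mathcal R(A,B)=\operatorname{Im}[B\ AB\ \cdots\ A^{N-1}B]$ and $\mathcal N(C,A)=\bigcap_{k=0}^{N-1}\ker CA^k$. Write $\mathcal R=\mathcal R(A,B)$ and $\mathcal N=\mathcal N(C,A)$. Put $\mathcal R_i=\mathcal R(A({\downarrow}i,{\downarrow}i),B({\downarrow}i,i))\subseteq\mathcal X_{{\downarrow}i}$ and $\mathcal N_i=\mathcal N(C(i,{\uparrow}i),A({\uparrow}i,{\uparrow}i))\subseteq\mathcal X_{{\uparrow}i}$. For $i\in{\downarrow}j$: $\overline{\mathcal R}_i^j=\mathcal X_i\cap\mathcal R_j$, $\widetilde{\mathcal R}_i^j=P_{\mathcal X_i}\mathcal R_j$. For $j\in{\uparrow}i$: $\overline{\mathcal N}_i^j=\mathcal N_i\cap\mathcal X_j$, $\widetilde{\mathcal N}_i^j=P_{\mathcal X_j}\mathcal N_i$. For $j\in P$: $$\overline{\mathcal R}_j=\sum_{i\in{\uparrow}j}\overline{\mathcal R}_j^i,\quad\mathcal R_j^\circ=\mathcal X_j\cap\mathcal R,\quad\widetilde{\mathcal R}_j=\sum_{i\in{\uparrow}j}\widetilde{\mathcal R}_j^i,\quad\overline{\mathcal N}^j=\bigcap_{i\in{\downarrow}j}\overline{\mathcal N}_i^j,\quad\mathcal N^{\circ j}=P_{\mathcal X_j}\mathcal N,\quad\widetilde{\mathcal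 N}^j=\bigcap_{i\in{\downarrow}j}\widetilde{\mathcal N}_i^j.$$ Then $\overline{\mathcal R},\mathcal R^\circ,\widetilde{\mathcal R},\overline{\mathcal N},\mathcal N^\circ,\widetilde{\mathcal N}$ are the direct sums over $j\in P$ of the respective component subspaces. A superscript $d$ in $(\cdot)^d$ means the same construction applied to the dual system (with poset $\mathcal P_d$ and matrices $A^\intercal,C^\intercal,B^\intercal,D^\intercal$ in place of $A,B,C,D$). A poset-causal system is weakly upstream controllable if $\widetilde{\mathcal R}=\mathcal X$, weakly downstream observable if $\overline{\mathcal N}=\{0\}$, weakly locally controllable if $\widetilde{\mathcal R}_i^i=\mathcal X_i$ for all $i\in P$, and weakly locally observable if $\overline{\mathcal N}_i^i=\{0\}$ for all $i\in P$. *)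

theory Defs
  imports "Jordan_Normal_Form.Matrix_Kernel" "Jordan_Normal_Form.DL_Submatrix"
begin

section \<open>Poset-causal systems\<close>

text \<open>
  The poset is \<open>{1..np}\<close> with \<open>(i, j) \<in> geq\<close> meaning that \<open>i\<close> is above or equal to \<open>j\<close>.
  \<open>xdim\<close>, \<open>udim\<close>, \<open>ydim\<close> are the partitions of the state, input and output space
  (values outside \<open>{1..np}\<close> are irrelevant, block sizes may be zero). The system matrices are
  ordinary real matrices whose rows and columns are cut into consecutive blocks by these partitions.
\<close>

record poset_system =
  np :: nat
  geq :: "(nat \<times> nat) set"
  xdim :: "nat \<Rightarrow> nat"
  udim :: "nat \<Rightarrow> nat"
  ydim :: "nat \<Rightarrow> nat"
  Am :: "real mat"
  Bm :: "real mat"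
  Cm :: "real mat"
  Dm :: "real mat"

definition total :: "nat \<Rightarrow> (nat \<Rightarrow> nat) \<Rightarrow> nat" where
  "total p n = (\<Sum>k\<in>{1..p}. n k)"

text \<open>Coordinates (counted from 0) that belong to block \<open>i\<close>, and to the blocks in \<open>S\<close>.\<close>

definition block :: "(nat \<Rightarrow> nat) \<Rightarrow> nat \<Rightarrow> nat set" where
  "block n i = {(\<Sum>k\<in>{1..<i}. n k) ..< (\<Sum>k\<in>{1..<i}. n k) + n i}"

definition blocks :: "(nat \<Rightarrow> nat) \<Rightarrow> nat set \<Rightarrow> nat set" where
  "blocks n S = (\<Union>i\<in>S. block n i)"

text \<open>$G(R,S)$ for \<open>G\<close> with row partition \<open>n\<close> and column partition \<open>m\<close>.\<close>

definition block_sub ::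
  "(nat \<Rightarrow> nat) \<Rightarrow> (nat \<Rightarrow> nat) \<Rightarrow> real mat \<Rightarrow> nat set \<Rightarrow> nat set \<Rightarrow> real mat" where
  "block_sub n m G R S = submatrix G (blocks n R) (blocks m S)"

definition incidence ::
  "nat \<Rightarrow> (nat \<times> nat) set \<Rightarrow> (nat \<Rightarrow> nat) \<Rightarrow> (nat \<Rightarrow> nat) \<Rightarrow> real mat set" where
  "incidence p ge n m =
     {G \<in> carrier_mat (total p n) (total p m).
        \<forall>i\<in>{1..p}. \<forall>j\<in>{1..p}. (j, i) \<notin> ge \<longrightarrow> block_sub n m G {i} {j} = 0\<^sub>m (n i) (m j)}"

definition poset_causal :: "poset_system \<Rightarrow> bool" where
  "poset_causal \<Sigma> \<longleftrightarrow>
     partial_order_on {1..np \<Sigma>} (geq \<Sigma>) \<and>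
     Am \<Sigma> \<in> incidence (np \<Sigma>) (geq \<Sigma>) (xdim \<Sigma>) (xdim \<Sigma>) \<and>
     Bm \<Sigma> \<in> incidence (np \<Sigma>) (geq \<Sigma>) (xdim \<Sigma>) (udim \<Sigma>) \<and>
     Cm \<Sigma> \<in> incidence (np \<Sigma>) (geq \<Sigma>) (ydim \<Sigma>) (xdim \<Sigma>) \<and>
     Dm \<Sigma> \<in> incidence (np \<Sigma>) (geq \<Sigma>) (ydim \<Sigma>) (udim \<Sigma>)"

definition dual_system :: "poset_system \<Rightarrow> poset_system" where
  "dual_system \<Sigma> =
     \<lparr> np = np \<Sigma>, geq = (geq \<Sigma>)\<inverse>,
       xdim = xdim \<Sigma>, udim = ydim \<Sigma>, ydim = udim \<Sigma>,
       Am = (Am \<Sigma>)\<^sup>T, Bm = (Cm \<Sigma>)\<^sup>T, Cm = (Bm \<Sigma>)\<^sup>T, Dm = (Dm \<Sigma>)\<^sup>T \<rparr>"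

lemma dual_incidence:
  assumes "G \<in> incidence p ge n m"
  shows "G\<^sup>T \<in> incidence p (ge\<inverse>) m n"
proof -
  have tr: "submatrix (G\<^sup>T) J I = (submatrix G I J)\<^sup>T" for I J
    by (intro eq_matI) (auto simp: submatrix_def intro!: index_transpose_mat pick_le)
  show ?thesis
    using assms by (auto simp: incidence_def block_sub_def tr)
qed

lemma poset_causal_dual: "poset_causal \<Sigma> \<Longrightarrow> poset_causal (dual_system \<Sigma>)"
  by (auto simp: poset_causal_def dual_system_def dual_incidence)


section \<open>Subspaces\<close>

text \<open>The block row $[B\ AB\ \cdots\ A^{N-1}B]$; column \<open>j\<close> lies in block \<open>j div dim_col B\<close>.\<close>

definition ctrb_mat :: "real mat \<Rightarrow> real mat \<Rightarrow> real mat" where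
  "ctrb_mat A B =
     mat (dim_row A) (dim_row A * dim_col B)
       (\<lambda>(i, j). (A ^\<^sub>m (j div dim_col B) * B) $$ (i, j mod dim_col B))"

definition reach :: "real mat \<Rightarrow> real mat \<Rightarrow> real vec set" where
  "reach A B = (\<lambda>v. ctrb_mat A B *\<^sub>v v) ` carrier_vec (dim_col (ctrb_mat A B))"

text \<open>Intersecting with \<open>carrier_vec\<close> matters only for \<open>N = 0\<close>, where the index set is empty.\<close>

definition unobs :: "real mat \<Rightarrow> real mat \<Rightarrow> real vec set" where
  "unobs C A = carrier_vec (dim_row A) \<inter> (\<Inter>k\<in>{..<dim_row A}. mat_kernel (C * A ^\<^sub>m k))"

definition orth_compl :: "nat \<Rightarrow> real vec set \<Rightarrow> real vec set" where
  "orth_compl N V = {x \<in> carrier_vec N. \<forall>y\<in>V. x \<bullet> y = 0}"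

definition subspace_sum :: "nat \<Rightarrow> 'i set \<Rightarrow> ('i \<Rightarrow> real vec set) \<Rightarrow> real vec set" where
  "subspace_sum N I V = {finsum_vec TYPE(real) N f I | f. \<forall>i\<in>I. f i \<in> V i}"

text \<open>
  Coordinates \<open>K\<close> of $\mathbb R^N$: the subspace of vectors supported on \<open>K\<close>, the orthogonal
  projection onto it, and the inclusion of $\mathbb R^{|K|}$ into $\mathbb R^N$ that places the
  entries at the positions \<open>K\<close> in increasing order (the same order as in \<^const>\<open>submatrix\<close>).
\<close>

definition coord_space :: "nat \<Rightarrow> nat set \<Rightarrow> real vec set" where
  "coord_space N K = {x \<in> carrier_vec N. \<forall>k<N. k \<notin> K \<longrightarrow> x $ k = 0}"

definition coord_proj :: "nat \<Rightarrow> nat set \<Rightarrow> real vec \<Rightarrow> real vec" where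
  "coord_proj N K x = vec N (\<lambda>k. if k \<in> K then x $ k else 0)"

definition coord_embed :: "nat \<Rightarrow> nat set \<Rightarrow> real vec \<Rightarrow> real vec" where
  "coord_embed N K v = vec N (\<lambda>k. if k \<in> K then v $ card {a \<in> K. a < k} else 0)"


section \<open>Structured subspaces of a poset-causal system\<close>

definition poset_elems :: "poset_system \<Rightarrow> nat set" where
  "poset_elems \<Sigma> = {1..np \<Sigma>}"

definition down :: "poset_system \<Rightarrow> nat \<Rightarrow> nat set" where
  "down \<Sigma> i = {j \<in> poset_elems \<Sigma>. (i, j) \<in> geq \<Sigma>}"

definition up :: "poset_system \<Rightarrow> nat \<Rightarrow> nat set" where
  "up \<Sigma> i = {j \<in> poset_elems \<Sigma>. (j, i) \<in> geq \<Sigma>}"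

definition xtot :: "poset_system \<Rightarrow> nat" where
  "xtot \<Sigma> = total (np \<Sigma>) (xdim \<Sigma>)"

definition state_space :: "poset_system \<Rightarrow> real vec set" where
  "state_space \<Sigma> = carrier_vec (xtot \<Sigma>)"

definition perp :: "poset_system \<Rightarrow> real vec set \<Rightarrow> real vec set" where
  "perp \<Sigma> V = orth_compl (xtot \<Sigma>) V"

text \<open>$\mathcal X_i$ and $P_{\mathcal X_i}$, with $\mathcal X_i$ viewed as a subspace of $\mathcal X$.\<close>

definition local_space :: "poset_system \<Rightarrow> nat \<Rightarrow> real vec set" where
  "local_space \<Sigma> i = coord_space (xtot \<Sigma>) (block (xdim \<Sigma>) i)"

definition local_proj :: "poset_system \<Rightarrow> nat \<Rightarrow> real vec \<Rightarrow> real vec" where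
  "local_proj \<Sigma> i = coord_proj (xtot \<Sigma>) (block (xdim \<Sigma>) i)"

definition direct_sum :: "poset_system \<Rightarrow> (nat \<Rightarrow> real vec set) \<Rightarrow> real vec set" where
  "direct_sum \<Sigma> V = subspace_sum (xtot \<Sigma>) (poset_elems \<Sigma>) V"

definition R_glob :: "poset_system \<Rightarrow> real vec set" where
  "R_glob \<Sigma> = reach (Am \<Sigma>) (Bm \<Sigma>)"

definition N_glob :: "poset_system \<Rightarrow> real vec set" where
  "N_glob \<Sigma> = unobs (Cm \<Sigma>) (Am \<Sigma>)"

text \<open>$\mathcal R_i$ and $\mathcal N_i$, embedded into $\mathcal X$ via
  $\mathcal X_{{\downarrow}i}$ and $\mathcal X_{{\uparrow}i}$.\<close>

definition R_at :: "poset_system \<Rightarrow> nat \<Rightarrow> real vec set" where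
  "R_at \<Sigma> i =
     coord_embed (xtot \<Sigma>) (blocks (xdim \<Sigma>) (down \<Sigma> i)) `
       reach (block_sub (xdim \<Sigma>) (xdim \<Sigma>) (Am \<Sigma>) (down \<Sigma> i) (down \<Sigma> i))
             (block_sub (xdim \<Sigma>) (udim \<Sigma>) (Bm \<Sigma>) (down \<Sigma> i) {i})"

definition N_at :: "poset_system \<Rightarrow> nat \<Rightarrow> real vec set" where
  "N_at \<Sigma> i =
     coord_embed (xtot \<Sigma>) (blocks (xdim \<Sigma>) (up \<Sigma> i)) `
       unobs (block_sub (ydim \<Sigma>) (xdim \<Sigma>) (Cm \<Sigma>) {i} (up \<Sigma> i))
             (block_sub (xdim \<Sigma>) (xdim \<Sigma>) (Am \<Sigma>) (up \<Sigma> i) (up \<Sigma> i))"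

text \<open>
  Index order: \<open>R_bar_comp \<Sigma> i j\<close> is $\overline{\mathcal R}_i^j$ and \<open>N_bar_comp \<Sigma> i j\<close> is
  $\overline{\mathcal N}_i^j$ (lower index first), and likewise for the tilde versions.
\<close>

definition R_bar_comp :: "poset_system \<Rightarrow> nat \<Rightarrow> nat \<Rightarrow> real vec set" where
  "R_bar_comp \<Sigma> i j = local_space \<Sigma> i \<inter> R_at \<Sigma> j"

definition R_tilde_comp :: "poset_system \<Rightarrow> nat \<Rightarrow> nat \<Rightarrow> real vec set" where
  "R_tilde_comp \<Sigma> i j = local_proj \<Sigma> i ` R_at \<Sigma> j"

definition N_bar_comp :: "poset_system \<Rightarrow> nat \<Rightarrow> nat \<Rightarrow> real vec set" where
  "N_bar_comp \<Sigma> i j = N_at \<Sigma> i \<inter> local_space \<Sigma> j"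

definition N_tilde_comp :: "poset_system \<Rightarrow> nat \<Rightarrow> nat \<Rightarrow> real vec set" where
  "N_tilde_comp \<Sigma> i j = local_proj \<Sigma> j ` N_at \<Sigma> i"

definition R_bar :: "poset_system \<Rightarrow> real vec set" where
  "R_bar \<Sigma> = direct_sum \<Sigma> (\<lambda>j. subspace_sum (xtot \<Sigma>) (up \<Sigma> j) (\<lambda>i. R_bar_comp \<Sigma> j i))"

definition R_circ :: "poset_system \<Rightarrow> real vec set" where
  "R_circ \<Sigma> = direct_sum \<Sigma> (\<lambda>j. local_space \<Sigma> j \<inter> R_glob \<Sigma>)"

definition R_tilde :: "poset_system \<Rightarrow> real vec set" where
  "R_tilde \<Sigma> = direct_sum \<Sigma> (\<lambda>j. subspace_sum (xtot \<Sigma>) (up \<Sigma> j) (\<lambda>i. R_tilde_comp \<Sigma> j i))"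

definition N_bar :: "poset_system \<Rightarrow> real vec set" where
  "N_bar \<Sigma> = direct_sum \<Sigma> (\<lambda>j. \<Inter>i\<in>down \<Sigma> j. N_bar_comp \<Sigma> i j)"

definition N_circ :: "poset_system \<Rightarrow> real vec set" where
  "N_circ \<Sigma> = direct_sum \<Sigma> (\<lambda>j. local_proj \<Sigma> j ` N_glob \<Sigma>)"

definition N_tilde :: "poset_system \<Rightarrow> real vec set" where
  "N_tilde \<Sigma> = direct_sum \<Sigma> (\<lambda>j. \<Inter>i\<in>down \<Sigma> j. N_tilde_comp \<Sigma> i j)"

definition weakly_upstream_controllable :: "poset_system \<Rightarrow> bool" where
  "weakly_upstream_controllable \<Sigma> \<longleftrightarrow> R_tilde \<Sigma> = state_space \<Sigma>"

definition weakly_downstream_observable :: "poset_system \<Rightarrow> bool" where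
  "weakly_downstream_observable \<Sigma> \<longleftrightarrow> N_bar \<Sigma> = {0\<^sub>v (xtot \<Sigma>)}"

definition weakly_locally_controllable :: "poset_system \<Rightarrow> bool" where
  "weakly_locally_controllable \<Sigma> \<longleftrightarrow>
     (\<forall>i\<in>poset_elems \<Sigma>. R_tilde_comp \<Sigma> i i = local_space \<Sigma> i)"

definition weakly_locally_observable :: "poset_system \<Rightarrow> bool" where
  "weakly_locally_observable \<Sigma> \<longleftrightarrow>
     (\<forall>i\<in>poset_elems \<Sigma>. N_bar_comp \<Sigma> i i = {0\<^sub>v (xtot \<Sigma>)})"

end

theory Submission
  imports Defs
begin

text \<open>
  All identities reduce to finite-dimensional double orthogonality $V^{\perp\perp} = V$.
  Kalman duality \<open>orth_compl N (reach A B) = unobs (B\<^sup>T) (A\<^sup>T)\<close>, applied to the diagonal blocks over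
  ${\downarrow}i$, says that $\mathcal N_i$ of the dual system is the complement of $\mathcal R_i$
  inside $\mathcal X_{{\downarrow}i}$. Complements taken inside a local space $\mathcal X_j$ exchange
  intersection with $\mathcal X_j$ and projection to it, exchange sums and intersections, and commute
  with the direct sum over \<open>j\<close>. This computes the complements of the three reachability subspaces of
  any system; the remaining identities follow by double orthogonality and by passing to the dual.
\<close>

section \<open>Subspaces and orthogonal complements\<close>

text \<open>The type \<open>real vec\<close> contains vectors of every length, so the ambient
  dimension \<open>N\<close> is a parameter and all closure conditions live inside
  \<open>carrier_vec N\<close>.\<close>

definition lin_subspace :: "nat \<Rightarrow> real vec set \<Rightarrow> bool" where
  "lin_subspace N V \<longleftrightarrow> V \<subseteq> carrier_vec N \<and> 0\<^sub>v N \<in> V \<and>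
     (\<forall>x\<in>V. \<forall>y\<in>V. x + y \<in> V) \<and> (\<forall>c. \<forall>x\<in>V. c \<cdot>\<^sub>v x \<in> V)"

lemma lin_subspaceI:
  assumes "V \<subseteq> carrier_vec N" "0\<^sub>v N \<in> V" "\<And>x y. x \<in> V \<Longrightarrow> y \<in> V \<Longrightarrow> x + y \<in> V"
    "\<And>c x. x \<in> V \<Longrightarrow> c \<cdot>\<^sub>v x \<in> V"
  shows "lin_subspace N V"
  using assms by (auto simp: lin_subspace_def)

lemma lin_subspaceD:
  assumes "lin_subspace N V"
  shows "V \<subseteq> carrier_vec N" "0\<^sub>v N \<in> V" "\<And>x y. x \<in> V \<Longrightarrow> y \<in> V \<Longrightarrow> x + y \<in> V"
    "\<And>c x. x \<in> V \<Longrightarrow> c \<cdot>\<^sub>v x \<in> V"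
  using assms by (auto simp: lin_subspace_def)

lemma lin_subspace_Int:
  "lin_subspace N V \<Longrightarrow> lin_subspace N W \<Longrightarrow> lin_subspace N (V \<inter> W)"
  by (auto simp: lin_subspace_def)

text \<open>Serves for projections, embeddings and matrix maps alike. Additivity and homogeneity are
  asked only on \<open>carrier_vec M\<close>, because coordinatewise maps give them only where the
  entries they read are in range.\<close>

lemma lin_subspace_image:
  assumes V: "lin_subspace M V" and T: "\<And>x. T x \<in> carrier_vec N"
    and add: "\<And>x y. x \<in> carrier_vec M \<Longrightarrow> y \<in> carrier_vec M \<Longrightarrow> T (x + y) = T x + T y"
    and smult: "\<And>c x. x \<in> carrier_vec M \<Longrightarrow> T (c \<cdot>\<^sub>v x) = c \<cdot>\<^sub>v T x"
  shows "lin_subspace N (T ` V)"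
proof (rule lin_subspaceI)
  note VD = lin_subspaceD[OF V]
  show "T ` V \<subseteq> carrier_vec N" using T by auto
  have "T (0 \<cdot>\<^sub>v 0\<^sub>v M) = 0 \<cdot>\<^sub>v T (0\<^sub>v M)" by (rule smult) simp
  moreover have "0 \<cdot>\<^sub>v T (0\<^sub>v M) = 0\<^sub>v N" using T[of "0\<^sub>v M"] by auto
  moreover have "0 \<cdot>\<^sub>v 0\<^sub>v M = (0\<^sub>v M :: real vec)" by auto
  ultimately have "T (0\<^sub>v M) = 0\<^sub>v N" by metis
  then show "0\<^sub>v N \<in> T ` V" using VD(2) by (metis imageI)
  show "x + y \<in> T ` V" if xy: "x \<in> T ` V" "y \<in> T ` V" for x y
  proof -
    obtain a b where ab: "a \<in> V" "b \<in> V" "x = T a" "y = T b" using xy by auto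
    then have "x + y = T (a + b)" using add[of a b] subsetD[OF VD(1)] by simp
    then show ?thesis using ab VD(3) by blast
  qed
  show "c \<cdot>\<^sub>v x \<in> T ` V" if x: "x \<in> T ` V" for c x
  proof -
    obtain a where a: "a \<in> V" "x = T a" using x by auto
    then have "c \<cdot>\<^sub>v x = T (c \<cdot>\<^sub>v a)" using smult VD(1) by auto
    then show ?thesis using a VD(4) by blast
  qed
qed

section \<open>Orthogonal complements and double orthogonality\<close>

lemma orth_compl_iff:
  "x \<in> orth_compl N V \<longleftrightarrow> x \<in> carrier_vec N \<and> (\<forall>y\<in>V. x \<bullet> y = 0)"
  by (simp add: orth_compl_def)

lemma lin_subspace_orth_compl:
  assumes "V \<subseteq> carrier_vec N"
  shows "lin_subspace N (orth_compl N V)"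
  using assms
  by (intro lin_subspaceI) (auto simp: orth_compl_iff add_scalar_prod_distrib[of _ N] subset_iff)

lemma scalar_prod_self_eq_0:
  assumes "(x :: real vec) \<in> carrier_vec N" "x \<bullet> x = 0"
  shows "x = 0\<^sub>v N"
proof (rule eq_vecI)
  have "(\<Sum>i\<in>{0..<N}. x $ i * x $ i) = 0" using assms by (simp add: scalar_prod_def)
  then have "\<forall>i\<in>{0..<N}. x $ i * x $ i = 0"
    by (subst (asm) sum_nonneg_eq_0_iff) auto
  then show "x $ i = 0\<^sub>v N $ i" if "i < dim_vec (0\<^sub>v N :: real vec)" for i using that by simp
qed (use assms in auto)

text \<open>Orthogonal projections are built by allowing one more nonzero coordinate at a time:
  each step enlarges the subspace by at most one direction, made orthogonal to the earlier ones.\<close>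

lemma orth_projection_exists_aux:
  assumes V: "lin_subspace N V" and "x \<in> carrier_vec N" and "K \<le> N"
  shows "\<exists>v\<in>V \<inter> {w. \<forall>k<N. K \<le> k \<longrightarrow> w $ k = 0}.
           \<forall>u\<in>V \<inter> {w. \<forall>k<N. K \<le> k \<longrightarrow> w $ k = 0}. (x - v) \<bullet> u = 0"
  using assms(2,3)
proof (induction K arbitrary: x)
  case 0
  note VD = lin_subspaceD[OF V]
  have u0: "u = 0\<^sub>v N" if "u \<in> V" "\<forall>k<N. 0 \<le> k \<longrightarrow> u $ k = 0" for u
    using that VD(1) by (intro eq_vecI) auto
  have perp0: "(x - 0\<^sub>v N) \<bullet> 0\<^sub>v N = 0" using 0 by simp
  show ?case
  proof (intro bexI[of _ "0\<^sub>v N"] ballI)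
    show "(x - 0\<^sub>v N) \<bullet> u = 0" if "u \<in> V \<inter> {w. \<forall>k<N. 0 \<le> k \<longrightarrow> w $ k = 0}" for u
    proof -
      have "u = 0\<^sub>v N" by (rule u0) (use that in auto)
      then show ?thesis using perp0 by simp
    qed
  qed (use VD(2) in simp)
next
  case (Suc K)
  note VD = lin_subspaceD[OF V]
  \<comment> \<open>The filtration of the induction: members of \<open>V\<close> supported on the
    first \<open>L\<close> coordinates.\<close>
  define U where "U L = V \<inter> {w. \<forall>k<N. L \<le> k \<longrightarrow> w $ k = 0}" for L
  have IH: "\<exists>v\<in>U K. \<forall>u\<in>U K. (x - v) \<bullet> u = 0" if "x \<in> carrier_vec N" for x
    using Suc.IH[OF that] Suc.prems unfolding U_def by simp
  have car: "u \<in> carrier_vec N" if "u \<in> U L" for u L using that VD(1) by (auto simp: U_def)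
  have K: "K < N" using Suc.prems by simp
  have sub: "U K \<subseteq> U (Suc K)" by (auto simp: U_def)
  have UK: "u \<in> U K \<longleftrightarrow> u \<in> U (Suc K) \<and> u $ K = 0" for u
    using K by (auto simp: U_def less_Suc_eq_le) (metis le_neq_implies_less less_eq_Suc_le)
  obtain p where p: "p \<in> U K" "\<And>u. u \<in> U K \<Longrightarrow> (x - p) \<bullet> u = 0" using IH[OF Suc.prems(1)] by blast
  have lin: "a + c \<cdot>\<^sub>v b \<in> U L" if "a \<in> U L" "b \<in> U L" for a b c L
    using that car[OF that(1)] car[OF that(2)] VD(3,4) by (auto simp: U_def)
  have "\<exists>v\<in>U (Suc K). \<forall>u\<in>U (Suc K). (x - v) \<bullet> u = 0"
  proof (cases "U (Suc K) = U K")
    case True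
    then show ?thesis using p by auto
  next
    case False
    \<comment> \<open>\<open>U K\<close> is the part of \<open>U (Suc K)\<close> on which entry
      \<open>K\<close> vanishes, so strict growth yields a vector with nonzero entry there.\<close>
    then obtain w0 where w0: "w0 \<in> U (Suc K)" "w0 $ K \<noteq> 0" using sub UK by blast
    obtain q where q: "q \<in> U K" "\<And>u. u \<in> U K \<Longrightarrow> (w0 - q) \<bullet> u = 0"
      using IH[OF car[OF w0(1)]] by blast
    \<comment> \<open>Gram-Schmidt step: subtracting the projection \<open>q\<close> of
      \<open>w0\<close> to \<open>U K\<close> makes \<open>w\<close> orthogonal to
      \<open>U K\<close>, and entry \<open>K\<close> stays nonzero because \<open>q\<close> vanishes
      there.\<close>
    define w where "w = w0 + (-1) \<cdot>\<^sub>v q"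
    have wq: "w = w0 - q" using car[OF w0(1)] car[OF q(1)] by (auto simp: w_def)
    have w: "w \<in> U (Suc K)" unfolding w_def using lin w0 q sub by blast
    have wc: "w \<in> carrier_vec N" using car w .
    have wK: "w $ K \<noteq> 0" using w0 q(1) car[OF q(1)] K UK by (auto simp: wq)
    have wperp: "w \<bullet> u = 0" if "u \<in> U K" for u using q(2)[OF that] wq by simp
    have ww: "w \<bullet> w \<noteq> 0" using scalar_prod_self_eq_0[OF wc] wK K by auto
    have pc: "p \<in> carrier_vec N" using car p(1) .
    \<comment> \<open>The coefficient of \<open>x\<close> along \<open>w\<close>. As
      \<open>p\<close> is orthogonal to \<open>w\<close>, it makes \<open>x - v\<close> orthogonal
      to \<open>w\<close> while leaving products with \<open>U K\<close> unchanged.\<close>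
    define c where "c = (x \<bullet> w) / (w \<bullet> w)"
    define v where "v = p + c \<cdot>\<^sub>v w"
    have v: "v \<in> U (Suc K)" unfolding v_def using lin p(1) w sub by blast
    have xv: "(x - v) \<bullet> u = (x - p) \<bullet> u - c * (w \<bullet> u)" if "u \<in> carrier_vec N" for u
      using that pc wc Suc.prems(1)
      by (simp add: v_def minus_scalar_prod_distrib[of _ N] add_scalar_prod_distrib[of _ N])
    have "p \<bullet> w = 0" using wperp[OF p(1)] comm_scalar_prod[OF pc wc] by simp
    then have xvw: "(x - v) \<bullet> w = 0"
      using xv[OF wc] ww Suc.prems(1) pc wc by (simp add: c_def minus_scalar_prod_distrib[of _ N])
    have "(x - v) \<bullet> u = 0" if u: "u \<in> U (Suc K)" for u
    proof -
      \<comment> \<open>Chosen to cancel entry \<open>K\<close> of \<open>u\<close>: then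
        \<open>u'\<close> lies in \<open>U K\<close>, so \<open>U (Suc K)\<close> is spanned by
        \<open>U K\<close> and \<open>w\<close>, and orthogonality to these two suffices.\<close>
      define d where "d = u $ K / w $ K"
      define u' where "u' = u + (-d) \<cdot>\<^sub>v w"
      have uc: "u \<in> carrier_vec N" using car u .
      have "u' \<in> U (Suc K)" unfolding u'_def using lin u w by blast
      moreover have "u' $ K = 0" using K uc wc wK by (simp add: u'_def d_def)
      ultimately have u': "u' \<in> U K" using UK by blast
      have u'c: "u' \<in> carrier_vec N" using car u' .
      have "u = u' + d \<cdot>\<^sub>v w" using uc wc by (intro eq_vecI) (auto simp: u'_def)
      moreover have "(x - v) \<bullet> u' = 0" using xv[OF u'c] p(2)[OF u'] wperp[OF u'] by simp
      ultimately show ?thesis using xvw u'c wc Suc.prems(1) car[OF v]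
        by (simp add: scalar_prod_add_distrib[of _ N])
    qed
    then show ?thesis using v by blast
  qed
  then show ?case unfolding U_def .
qed

lemma orth_projection_exists:
  assumes V: "lin_subspace N V" and x: "x \<in> carrier_vec N"
  obtains v where "v \<in> V" "\<And>u. u \<in> V \<Longrightarrow> (x - v) \<bullet> u = 0"
  using orth_projection_exists_aux[OF V x order_refl] by auto

text \<open>For the nontrivial inclusion let \<open>v\<close> be the orthogonal projection of
  \<open>x\<close> to \<open>V\<close>. The difference \<open>x - v\<close> lies in the complement
  of \<open>V\<close>, and both \<open>x\<close> and \<open>v\<close> are orthogonal to that
  complement; hence \<open>x - v\<close> is orthogonal to itself and vanishes.\<close>

lemma orth_compl_orth_compl:
  assumes V: "lin_subspace N V"
  shows "orth_compl N (orth_compl N V) = V"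
proof
  note VD = lin_subspaceD[OF V]
  show "V \<subseteq> orth_compl N (orth_compl N V)"
  proof
    fix x assume x: "x \<in> V"
    have "x \<bullet> y = 0" if "y \<in> orth_compl N V" for y
      using that x VD(1) comm_scalar_prod[of x N y] by (auto simp: orth_compl_iff)
    then show "x \<in> orth_compl N (orth_compl N V)" using x VD(1) by (auto simp: orth_compl_iff)
  qed
  show "orth_compl N (orth_compl N V) \<subseteq> V"
  proof
    fix x assume x: "x \<in> orth_compl N (orth_compl N V)"
    then have xc: "x \<in> carrier_vec N" by (simp add: orth_compl_iff)
    obtain v where v: "v \<in> V" "\<And>u. u \<in> V \<Longrightarrow> (x - v) \<bullet> u = 0"
      using orth_projection_exists[OF V xc] by blast
    have vc: "v \<in> carrier_vec N" using v VD(1) by auto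
    have d: "x - v \<in> orth_compl N V" using v vc xc by (simp add: orth_compl_iff)
    then have "x \<bullet> (x - v) = 0" "v \<bullet> (x - v) = 0"
      using x v vc xc comm_scalar_prod[of v N "x - v"] by (auto simp: orth_compl_iff)
    then have "(x - v) \<bullet> (x - v) = 0" using vc xc by (simp add: minus_scalar_prod_distrib[of _ N])
    then have "x - v = 0\<^sub>v N" using scalar_prod_self_eq_0 vc xc by simp
    then have "(x - v) $ k = 0" if "k < N" for k using that by simp
    then have "x = v" using vc xc by (intro eq_vecI) auto
    then show "x \<in> V" using v by simp
  qed
qed

section \<open>Finite sums of subspaces and their complements\<close>

lemma finsum_vec_carrier:
  "(\<And>i. i \<in> I \<Longrightarrow> f i \<in> carrier_vec N) \<Longrightarrow> finsum_vec TYPE(real) N f I \<in> carrier_vec N"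
  by (intro finsum_vec_closed) auto

lemma eq_finsum_vecI:
  assumes "finite I" "\<And>i. i \<in> I \<Longrightarrow> f i \<in> carrier_vec N" "x \<in> carrier_vec N"
    "\<And>k. k < N \<Longrightarrow> x $ k = (\<Sum>i\<in>I. f i $ k)"
  shows "x = finsum_vec TYPE(real) N f I"
proof (rule eq_vecI)
  have c: "finsum_vec TYPE(real) N f I \<in> carrier_vec N" using assms(2) by (rule finsum_vec_carrier)
  show "dim_vec x = dim_vec (finsum_vec TYPE(real) N f I)" using c assms(3) by simp
  show "x $ k = finsum_vec TYPE(real) N f I $ k" if "k < dim_vec (finsum_vec TYPE(real) N f I)" for k
    using that c assms by (auto simp: index_finsum_vec)
qed

lemma scalar_prod_finsum_vec:
  assumes "finite I" "\<And>i. i \<in> I \<Longrightarrow> f i \<in> carrier_vec N"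
  shows "(x :: real vec) \<bullet> finsum_vec TYPE(real) N f I = (\<Sum>i\<in>I. x \<bullet> f i)"
proof -
  have "x \<bullet> finsum_vec TYPE(real) N f I = (\<Sum>k<N. x $ k * (\<Sum>i\<in>I. f i $ k))"
    using finsum_vec_carrier[of I f N] assms
    by (auto simp: scalar_prod_def lessThan_atLeast0 index_finsum_vec intro!: sum.cong)
  also have "\<dots> = (\<Sum>i\<in>I. \<Sum>k<N. x $ k * f i $ k)"
    unfolding sum_distrib_left by (rule sum.swap)
  also have "\<dots> = (\<Sum>i\<in>I. x \<bullet> f i)"
    using assms(2) by (intro sum.cong refl) (simp add: scalar_prod_def lessThan_atLeast0 carrier_vecD[OF assms(2)])
  finally show ?thesis .
qed

text \<open>Together with \<open>subspace_sumI\<close> this replaces \<open>finsum_vec\<close> by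
  one equation of real sums per coordinate, the form in which later arguments treat sums of
  subspaces.\<close>

lemma subspace_sumE:
  assumes "x \<in> subspace_sum N I V" "finite I" "\<And>i. i \<in> I \<Longrightarrow> V i \<subseteq> carrier_vec N"
  obtains f where "\<And>i. i \<in> I \<Longrightarrow> f i \<in> V i" "\<And>i. i \<in> I \<Longrightarrow> f i \<in> carrier_vec N"
    "x = finsum_vec TYPE(real) N f I" "x \<in> carrier_vec N" "\<And>k. k < N \<Longrightarrow> x $ k = (\<Sum>i\<in>I. f i $ k)"
proof -
  obtain f where f: "\<forall>i\<in>I. f i \<in> V i" "x = finsum_vec TYPE(real) N f I"
    using assms(1) by (auto simp: subspace_sum_def)
  then have c: "\<And>i. i \<in> I \<Longrightarrow> f i \<in> carrier_vec N" using assms(3) by blast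
  show thesis
    by (rule that[of f]) (use f c assms(2) in \<open>auto intro!: finsum_vec_carrier index_finsum_vec\<close>)
qed

lemma subspace_sumI:
  assumes "finite I" "\<And>i. i \<in> I \<Longrightarrow> V i \<subseteq> carrier_vec N" "\<And>i. i \<in> I \<Longrightarrow> f i \<in> V i"
    "x \<in> carrier_vec N" "\<And>k. k < N \<Longrightarrow> x $ k = (\<Sum>i\<in>I. f i $ k)"
  shows "x \<in> subspace_sum N I V"
proof -
  have "x = finsum_vec TYPE(real) N f I"
    using assms by (intro eq_finsum_vecI) blast+
  then show ?thesis using assms(3) unfolding subspace_sum_def by blast
qed

lemma lin_subspace_subspace_sum:
  assumes I: "finite I" and V: "\<And>i. i \<in> I \<Longrightarrow> lin_subspace N (V i)"
  shows "lin_subspace N (subspace_sum N I V)"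
proof (rule lin_subspaceI)
  note VD = lin_subspaceD[OF V]
  note sumE = subspace_sumE[OF _ I VD(1)] and sumI = subspace_sumI[OF I VD(1)]
  show "subspace_sum N I V \<subseteq> carrier_vec N" by (auto elim: sumE)
  show "0\<^sub>v N \<in> subspace_sum N I V"
    by (rule sumI[where f="\<lambda>i. 0\<^sub>v N"]) (use VD(2) in auto)
  show "x + y \<in> subspace_sum N I V" if x: "x \<in> subspace_sum N I V" and y: "y \<in> subspace_sum N I V" for x y
  proof -
    obtain f where f: "\<And>i. i \<in> I \<Longrightarrow> f i \<in> V i" "\<And>i. i \<in> I \<Longrightarrow> f i \<in> carrier_vec N"
      "x \<in> carrier_vec N" "\<And>k. k < N \<Longrightarrow> x $ k = (\<Sum>i\<in>I. f i $ k)" by (rule sumE[OF x]) blast+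
    obtain g where g: "\<And>i. i \<in> I \<Longrightarrow> g i \<in> V i" "\<And>i. i \<in> I \<Longrightarrow> g i \<in> carrier_vec N"
      "y \<in> carrier_vec N" "\<And>k. k < N \<Longrightarrow> y $ k = (\<Sum>i\<in>I. g i $ k)" by (rule sumE[OF y]) blast+
    show ?thesis
    proof (rule sumI[where f="\<lambda>i. f i + g i"])
      fix k assume k: "k < N"
      have "(f i + g i) $ k = f i $ k + g i $ k" if "i \<in> I" for i
        using k g(2)[OF that] by simp
      then show "(x + y) $ k = (\<Sum>i\<in>I. (f i + g i) $ k)"
        using k f(3,4) g(3,4) by (simp add: sum.distrib)
    qed (use f g VD(3) in auto)
  qed
  show "c \<cdot>\<^sub>v x \<in> subspace_sum N I V" if x: "x \<in> subspace_sum N I V" for c x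
  proof -
    obtain f where f: "\<And>i. i \<in> I \<Longrightarrow> f i \<in> V i" "\<And>i. i \<in> I \<Longrightarrow> f i \<in> carrier_vec N"
      "x \<in> carrier_vec N" "\<And>k. k < N \<Longrightarrow> x $ k = (\<Sum>i\<in>I. f i $ k)" by (rule sumE[OF x]) blast+
    show ?thesis
    proof (rule sumI[where f="\<lambda>i. c \<cdot>\<^sub>v f i"])
      fix k assume k: "k < N"
      have "(c \<cdot>\<^sub>v f i) $ k = c * f i $ k" if "i \<in> I" for i
        using k f(2)[OF that] by simp
      then show "(c \<cdot>\<^sub>v x) $ k = (\<Sum>i\<in>I. (c \<cdot>\<^sub>v f i) $ k)"
        using k f(3,4) by (simp add: sum_distrib_left)
    qed (use f VD(4) in auto)
  qed
qed

lemma subset_subspace_sum: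
  assumes I: "finite I" "j \<in> I" and V: "\<And>i. i \<in> I \<Longrightarrow> lin_subspace N (V i)"
  shows "V j \<subseteq> subspace_sum N I V"
proof
  note VD = lin_subspaceD[OF V]
  fix x assume x: "x \<in> V j"
  show "x \<in> subspace_sum N I V"
  proof (rule subspace_sumI[OF I(1) VD(1)])
    show "(if i = j then x else 0\<^sub>v N) \<in> V i" if "i \<in> I" for i using x VD(2)[OF that] by auto
    show "x \<in> carrier_vec N" using x VD(1) I by blast
    fix k assume "k < N"
    then have "(\<Sum>i\<in>I. (if i = j then x else 0\<^sub>v N) $ k) = (\<Sum>i\<in>I. if i = j then x $ k else 0)"
      by (intro sum.cong) auto
    then show "x $ k = (\<Sum>i\<in>I. (if i = j then x else 0\<^sub>v N) $ k)" using I by simp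
  qed
qed

text \<open>One direction holds because each summand is contained in the sum, the other by linearity
  of the scalar product. The carrier conjunct matters when \<open>I\<close> is empty.\<close>

lemma orth_compl_subspace_sum:
  assumes I: "finite I" and V: "\<And>i. i \<in> I \<Longrightarrow> lin_subspace N (V i)"
  shows "x \<in> orth_compl N (subspace_sum N I V) \<longleftrightarrow>
         x \<in> carrier_vec N \<and> (\<forall>i\<in>I. x \<in> orth_compl N (V i))"
proof -
  note VD = lin_subspaceD[OF V]
  have "x \<bullet> y = 0" if perp: "\<forall>i\<in>I. \<forall>y\<in>V i. x \<bullet> y = 0" and y: "y \<in> subspace_sum N I V" for y
  proof -
    obtain f where f: "\<And>i. i \<in> I \<Longrightarrow> f i \<in> V i" "\<And>i. i \<in> I \<Longrightarrow> f i \<in> carrier_vec N"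
      "y = finsum_vec TYPE(real) N f I" by (rule subspace_sumE[OF y I VD(1)]) blast+
    have "x \<bullet> y = (\<Sum>i\<in>I. x \<bullet> f i)" unfolding f(3) by (rule scalar_prod_finsum_vec[OF I f(2)])
    also have "\<dots> = 0" using perp f(1) by (intro sum.neutral) blast
    finally show ?thesis .
  qed
  moreover have "V i \<subseteq> subspace_sum N I V" if "i \<in> I" for i
    by (rule subset_subspace_sum[OF I that V])
  ultimately show ?thesis unfolding orth_compl_iff by blast
qed

section \<open>Coordinate subspaces\<close>

lemma lin_subspace_coord_space: "lin_subspace N (coord_space N K)"
  by (intro lin_subspaceI) (auto simp: coord_space_def)

lemma coord_space_carrier: "coord_space N K \<subseteq> carrier_vec N"
  by (auto simp: coord_space_def)

lemma coord_space_mono: "J \<subseteq> K \<Longrightarrow> coord_space N J \<subseteq> coord_space N K"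
  by (auto simp: coord_space_def)

lemma coord_space_eq_carrier: "{..<N} \<subseteq> K \<Longrightarrow> coord_space N K = carrier_vec N"
  by (auto simp: coord_space_def)

lemma coord_proj_in: "coord_proj N K x \<in> coord_space N K"
  by (auto simp: coord_space_def coord_proj_def)

lemma coord_proj_carrier: "coord_proj N K x \<in> carrier_vec N"
  by (simp add: coord_proj_def)

lemma coord_proj_scalar_prod:
  "x \<in> carrier_vec N \<Longrightarrow> y \<in> coord_space N K \<Longrightarrow> coord_proj N K x \<bullet> y = x \<bullet> y"
  by (auto simp: scalar_prod_def coord_proj_def coord_space_def intro!: sum.cong)

lemma lin_subspace_coord_proj:
  assumes "lin_subspace N V"
  shows "lin_subspace N (coord_proj N K ` V)"
  by (rule lin_subspace_image[OF assms]) (auto simp: coord_proj_def)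

lemma scalar_prod_disjoint:
  assumes "x \<in> coord_space N J" "y \<in> coord_space N K" "J \<inter> K = {}"
  shows "x \<bullet> y = 0"
proof -
  have "x $ k * y $ k = 0" if "k < N" for k
    using assms that by (cases "k \<in> J") (auto simp: coord_space_def)
  moreover have "dim_vec y = N" using assms by (auto simp: coord_space_def)
  ultimately show ?thesis by (auto simp: scalar_prod_def intro!: sum.neutral)
qed

text \<open>Projecting a vector of the full complement of \<open>V\<close> to the coordinates
  \<open>K\<close> keeps it orthogonal to \<open>V\<close>, which is supported there, and keeps its
  product with any \<open>x\<close> supported on \<open>K\<close>. So orthogonality to the relative
  complement already gives orthogonality to the full one, and ordinary double orthogonality
  applies.\<close>

lemma orth_compl_within_coord_space:
  assumes V: "lin_subspace N V" and K: "V \<subseteq> coord_space N K"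
  shows "coord_space N K \<inter> orth_compl N (coord_space N K \<inter> orth_compl N V) = V" (is "?L = V")
proof
  note VD = lin_subspaceD[OF V]
  show "V \<subseteq> ?L"
  proof
    fix x assume x: "x \<in> V"
    then have "x \<in> orth_compl N (orth_compl N V)" using orth_compl_orth_compl[OF V] by simp
    then show "x \<in> ?L" using x K by (auto simp: orth_compl_iff)
  qed
  show "?L \<subseteq> V"
  proof
    fix x assume x: "x \<in> ?L"
    then have xc: "x \<in> carrier_vec N" by (simp add: orth_compl_iff)
    have "x \<bullet> y = 0" if y: "y \<in> orth_compl N V" for y
    proof -
      let ?p = "coord_proj N K y"
      have yc: "y \<in> carrier_vec N" using y by (simp add: orth_compl_iff)
      have "?p \<bullet> v = 0" if "v \<in> V" for v
        using y that coord_proj_scalar_prod[OF yc] K by (auto simp: orth_compl_iff)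
      then have "?p \<in> coord_space N K \<inter> orth_compl N V"
        by (simp add: coord_proj_in coord_proj_carrier orth_compl_iff)
      then have "x \<bullet> ?p = 0" using x by (simp add: orth_compl_iff)
      moreover have "?p \<bullet> x = y \<bullet> x" using x by (intro coord_proj_scalar_prod[OF yc]) auto
      ultimately show ?thesis
        using comm_scalar_prod[OF xc yc] comm_scalar_prod[OF xc coord_proj_carrier] by metis
    qed
    then have "x \<in> orth_compl N (orth_compl N V)" using xc by (simp add: orth_compl_iff)
    then show "x \<in> V" using orth_compl_orth_compl[OF V] by simp
  qed
qed

text \<open>Taking relative complements exchanges the zero space and the whole coordinate space.
  Both equivalences between controllability and observability rest on this.\<close>

lemma orth_compl_within_coord_space_eq_zero_iff:
  assumes "lin_subspace N V" "V \<subseteq> coord_space N K"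
  shows "coord_space N K \<inter> orth_compl N V = {0\<^sub>v N} \<longleftrightarrow>
    V = coord_space N K"
proof
  assume "coord_space N K \<inter> orth_compl N V = {0\<^sub>v N}"
  then have "V = coord_space N K \<inter> orth_compl N {0\<^sub>v N}"
    using orth_compl_within_coord_space[OF assms] by simp
  also have "\<dots> = coord_space N K" by (auto simp: orth_compl_iff coord_space_def)
  finally show "V = coord_space N K" .
next
  assume V: "V = coord_space N K"
  have "x = 0\<^sub>v N" if "x \<in> coord_space N K" "x \<in> orth_compl N V" for x
    using that scalar_prod_self_eq_0[of x N] by (simp add: V orth_compl_iff)
  moreover have "0\<^sub>v N \<in> coord_space N K \<inter> orth_compl N V"
    using lin_subspaceD(1,2)[OF lin_subspace_coord_space]
    by (auto simp: orth_compl_iff V subset_iff)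
  ultimately show "coord_space N K \<inter> orth_compl N V = {0\<^sub>v N}" by blast
qed

text \<open>The coordinate projection is self-adjoint and fixes vectors supported on
  \<open>J\<close>, so such vectors cannot distinguish \<open>R\<close> from its projection.\<close>

lemma orth_compl_coord_proj_image:
  assumes R: "R \<subseteq> carrier_vec N"
  shows "coord_space N J \<inter> orth_compl N (coord_proj N J ` R) = coord_space N J \<inter> orth_compl N R"
proof -
  have "x \<bullet> coord_proj N J y = x \<bullet> y" if x: "x \<in> coord_space N J" and y: "y \<in> R" for x y
  proof -
    have xc: "x \<in> carrier_vec N" and yc: "y \<in> carrier_vec N"
      using x y R coord_space_carrier by blast+
    show ?thesis
      using coord_proj_scalar_prod[OF yc x] comm_scalar_prod[OF xc yc]
        comm_scalar_prod[OF xc coord_proj_carrier[of N J y]] by simp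
  qed
  then show ?thesis by (auto simp: orth_compl_iff)
qed

text \<open>If \<open>M\<close> is the orthogonal complement of \<open>R\<close> relative to the coordinates \<open>K\<close>, then
  projecting \<open>M\<close> to the coordinates \<open>J\<close> is dual to intersecting \<open>R\<close> with them.\<close>

lemma orth_compl_Int_coord_space:
  assumes R: "lin_subspace N R" "R \<subseteq> coord_space N K" and J: "J \<subseteq> K"
    and M: "M = coord_space N K \<inter> orth_compl N R"
  shows "coord_space N J \<inter> orth_compl N (coord_space N J \<inter> R) = coord_proj N J ` M"
proof -
  have RK: "coord_space N K \<inter> orth_compl N M = R"
    unfolding M by (rule orth_compl_within_coord_space[OF R])
  have Msub: "lin_subspace N M"
    unfolding M using R(1) lin_subspace_coord_space lin_subspaceD(1) lin_subspace_orth_compl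
    by (intro lin_subspace_Int) auto
  \<comment> \<open>The dual identity is shown first: against vectors supported on \<open>J\<close>
    the projection of \<open>M\<close> acts like \<open>M\<close>, and
    \<open>J \<subseteq> K\<close> turns orthogonality to \<open>M\<close> into membership in
    \<open>R\<close>. A second relative complement, now inside \<open>J\<close>, gives the
    claim.\<close>
  have "coord_space N J \<inter> orth_compl N (coord_proj N J ` M) = coord_space N J \<inter> R"
    using orth_compl_coord_proj_image[OF lin_subspaceD(1)[OF Msub], of J] RK coord_space_mono[OF J, of N]
    by auto
  then show ?thesis
    using orth_compl_within_coord_space[OF lin_subspace_coord_proj[OF Msub], of J J]
    by (simp add: coord_proj_in image_subset_iff)
qed

text \<open>Vectors with disjoint supports are automatically orthogonal, so only the conditions
  inside each \<open>K i\<close> remain. Conversely, a vector orthogonal to the sum is the sum of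
  its projections to the \<open>K i\<close>, because these sets cover all coordinates.\<close>

lemma orth_compl_direct_sum:
  assumes I: "finite I" and cover: "{..<N} \<subseteq> (\<Union>i\<in>I. K i)"
    and disj: "disjoint_family_on K I"
    and V: "\<And>i. i \<in> I \<Longrightarrow> lin_subspace N (V i)" "\<And>i. i \<in> I \<Longrightarrow> V i \<subseteq> coord_space N (K i)"
  shows "orth_compl N (subspace_sum N I V) =
         subspace_sum N I (\<lambda>i. coord_space N (K i) \<inter> orth_compl N (V i))" (is "?L = ?R")
proof
  have car: "coord_space N (K i) \<inter> orth_compl N (V i) \<subseteq> carrier_vec N" for i
    by (auto simp: orth_compl_iff)
  show "?L \<subseteq> ?R"
  proof
    fix x assume "x \<in> ?L"
    then have x: "x \<in> carrier_vec N" "\<And>i. i \<in> I \<Longrightarrow> x \<in> orth_compl N (V i)"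
      using orth_compl_subspace_sum[OF I V(1)] by auto
    show "x \<in> ?R"
    proof (rule subspace_sumI[OF I car, of "\<lambda>i. coord_proj N (K i) x"])
      show "x \<in> carrier_vec N" by (rule x)
      show "coord_proj N (K i) x \<in> coord_space N (K i) \<inter> orth_compl N (V i)" if i: "i \<in> I" for i
      proof -
        have "coord_proj N (K i) x \<bullet> v = 0" if "v \<in> V i" for v
          using that coord_proj_scalar_prod[OF x(1), of v "K i"] V(2)[OF i] x(2)[OF i]
          by (auto simp: orth_compl_iff)
        then show ?thesis by (simp add: coord_proj_in coord_proj_carrier orth_compl_iff)
      qed
      fix k assume k: "k < N"
      then obtain i where i: "i \<in> I" "k \<in> K i" using cover by auto
      then have other: "k \<notin> K j" if "j \<in> I" "j \<noteq> i" for j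
        using that disj by (auto simp: disjoint_family_on_def)
      \<comment> \<open>By disjointness only the index whose coordinate set contains
        \<open>k\<close> contributes.\<close>
      have "(\<Sum>j\<in>I. coord_proj N (K j) x $ k) = (\<Sum>j\<in>I. if j = i then x $ k else 0)"
        using k i other by (intro sum.cong) (auto simp: coord_proj_def)
      then show "x $ k = (\<Sum>j\<in>I. coord_proj N (K j) x $ k)" using I i by simp
    qed
  qed
  show "?R \<subseteq> ?L"
  proof
    fix x assume xR: "x \<in> ?R"
    obtain f where f: "\<And>i. i \<in> I \<Longrightarrow> f i \<in> coord_space N (K i) \<inter> orth_compl N (V i)"
      "\<And>i. i \<in> I \<Longrightarrow> f i \<in> carrier_vec N"
      "x = finsum_vec TYPE(real) N f I" "x \<in> carrier_vec N"
      by (rule subspace_sumE[OF xR I car]) blast+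
    have "x \<bullet> v = 0" if i: "i \<in> I" and v: "v \<in> V i" for i v
    proof -
      have vc: "v \<in> carrier_vec N" and vK: "v \<in> coord_space N (K i)"
        using lin_subspaceD(1)[OF V(1)] V(2) i v by blast+
      have "v \<bullet> f j = 0" if j: "j \<in> I" for j
      proof (cases "j = i")
        case True
        have "f i \<bullet> v = 0" using f(1)[OF i] v by (simp add: orth_compl_iff)
        then show ?thesis using comm_scalar_prod[OF vc f(2)[OF i]] True by simp
      next
        case False
        then have "K i \<inter> K j = {}" using disj i j by (auto simp: disjoint_family_on_def)
        then show ?thesis using scalar_prod_disjoint[OF vK] f(1)[OF j] by blast
      qed
      then have "v \<bullet> x = 0" unfolding f(3) using scalar_prod_finsum_vec[OF I f(2)] by simp
      then show ?thesis using comm_scalar_prod[OF vc f(4)] by simp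
    qed
    then show "x \<in> ?L" using f(4) by (subst orth_compl_subspace_sum[OF I V(1)]) (auto simp: orth_compl_iff)
  qed
qed

section \<open>Embedding a smaller coordinate space at the positions \<open>K\<close>\<close>

lemma bij_betw_rank:
  fixes K :: "nat set"
  assumes "finite K"
  shows "bij_betw (\<lambda>k. card {a \<in> K. a < k}) K {..<card K}"
proof -
  \<comment> \<open>\<open>pick K\<close> recovers an element of \<open>K\<close> from its rank;
    surjectivity then follows by counting.\<close>
  have inj: "inj_on (\<lambda>k. card {a \<in> K. a < k}) K"
    by (rule inj_on_inverseI[of _ "pick K"]) (rule pick_card_in_set)
  moreover have "(\<lambda>k. card {a \<in> K. a < k}) ` K \<subseteq> {..<card K}"
    using assms by (auto intro!: psubset_card_mono)
  ultimately show ?thesis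
    using card_image[OF inj] by (simp add: bij_betw_def card_subset_eq)
qed

lemma coord_embed_in: "coord_embed N K v \<in> coord_space N K"
  by (auto simp: coord_space_def coord_embed_def)

lemma coord_embed_carrier: "coord_embed N K v \<in> carrier_vec N"
  by (simp add: coord_embed_def)

lemma rank_less_card:
  "finite K \<Longrightarrow> k \<in> K \<Longrightarrow> card {a \<in> K. a < k} < card (K :: nat set)"
  using bij_betwE[OF bij_betw_rank[of K]] by auto

lemma lin_subspace_coord_embed:
  assumes K: "K \<subseteq> {..<N}" and V: "lin_subspace (card K) V"
  shows "lin_subspace N (coord_embed N K ` V)"
  using rank_less_card[OF finite_subset[OF K]]
  by (intro lin_subspace_image[OF V]) (auto simp: coord_embed_def)

text \<open>Positions outside \<open>K\<close> contribute zero and those in \<open>K\<close> are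
  reindexed by their rank. Thus the embedding is an isometry, and orthogonality can be tested before
  embedding.\<close>

lemma coord_embed_scalar_prod:
  assumes K: "K \<subseteq> {..<N}" and v: "w \<in> carrier_vec (card K)"
  shows "coord_embed N K v \<bullet> coord_embed N K w = v \<bullet> w"
proof -
  let ?r = "\<lambda>k. card {a \<in> K. a < k}"
  have "coord_embed N K v \<bullet> coord_embed N K w = (\<Sum>k\<in>{0..<N}. if k \<in> K then v $ ?r k * w $ ?r k else 0)"
    by (auto simp: scalar_prod_def coord_embed_def intro!: sum.cong)
  also have "\<dots> = (\<Sum>k\<in>K. v $ ?r k * w $ ?r k)"
    using K by (intro sum.mono_neutral_cong_right) auto
  also have "\<dots> = (\<Sum>i<card K. v $ i * w $ i)"
    by (rule sum.reindex_bij_betw[OF bij_betw_rank]) (use K finite_subset in auto)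
  finally show ?thesis using v by (simp add: scalar_prod_def lessThan_atLeast0)
qed

lemma coord_embed_surj:
  assumes K: "K \<subseteq> {..<N}" and x: "x \<in> coord_space N K"
  obtains v where "v \<in> carrier_vec (card K)" "x = coord_embed N K v"
proof
  have fin: "finite K" using K finite_subset by blast
  \<comment> \<open>Reads the entries of \<open>x\<close> along \<open>K\<close> in increasing
    order, undoing the rank used by \<open>coord_embed\<close>.\<close>
  let ?v = "vec (card K) (\<lambda>i. x $ pick K i)"
  show "?v \<in> carrier_vec (card K)" by simp
  show "x = coord_embed N K ?v"
    using x K rank_less_card[OF fin]
    by (intro eq_vecI) (auto simp: coord_embed_def coord_space_def pick_card_in_set)
qed

text \<open>The embedding is an isometry onto the vectors supported on \<open>K\<close>, so it
  carries complements to complements. The cut with \<open>coord_space N K\<close> removes vectors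
  that are orthogonal to the image only because of entries outside \<open>K\<close>.\<close>

lemma orth_compl_coord_embed:
  assumes K: "K \<subseteq> {..<N}" and V: "V \<subseteq> carrier_vec (card K)"
  shows "coord_space N K \<inter> orth_compl N (coord_embed N K ` V) =
         coord_embed N K ` orth_compl (card K) V" (is "?L = ?R")
proof
  show "?R \<subseteq> ?L"
    using V coord_embed_scalar_prod[OF K] coord_embed_in[of N K] coord_embed_carrier[of N K]
    by (auto simp: orth_compl_iff subset_iff)
  show "?L \<subseteq> ?R"
  proof
    fix x assume x: "x \<in> ?L"
    obtain v where v: "v \<in> carrier_vec (card K)" "x = coord_embed N K v"
      by (rule coord_embed_surj[OF K, of x]) (use x in auto)
    have "v \<bullet> w = 0" if w: "w \<in> V" for w
    proof -
      have "x \<bullet> coord_embed N K w = 0" using x w by (auto simp: orth_compl_iff)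
      then show ?thesis using coord_embed_scalar_prod[OF K, of w v] V w v(2) by auto
    qed
    then show "x \<in> ?R" using v by (auto simp: orth_compl_iff)
  qed
qed


section \<open>Reachable and unobservable subspaces\<close>

lemma lin_subspace_mat_range:
  assumes M: "(M :: real mat) \<in> carrier_mat N c"
  shows "lin_subspace N ((\<lambda>v. M *\<^sub>v v) ` carrier_vec c)"
proof (rule lin_subspace_image)
  show "lin_subspace c (carrier_vec c)" by (intro lin_subspaceI) auto
  show "M *\<^sub>v x \<in> carrier_vec N" for x using M by (intro carrier_vecI) simp
qed (rule mult_add_distrib_mat_vec[OF M] mult_mat_vec[OF M]; assumption)+

lemma lin_subspace_reach:
  assumes "A \<in> carrier_mat N N"
  shows "lin_subspace N (reach A B)"
  unfolding reach_def
  by (rule lin_subspace_mat_range) (use assms in \<open>simp add: ctrb_mat_def\<close>)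

section \<open>Matrix powers and Kalman duality\<close>

lemma pow_mat_commute:
  assumes A: "(A :: real mat) \<in> carrier_mat N N"
  shows "A * A ^\<^sub>m k = A ^\<^sub>m k * A"
proof (induction k)
  case (Suc k)
  have P: "A ^\<^sub>m k \<in> carrier_mat N N" using A by (simp add: pow_carrier_mat)
  have "A * A ^\<^sub>m Suc k = (A * A ^\<^sub>m k) * A" using assoc_mult_mat[OF A P A] by simp
  then show ?case using Suc by simp
qed (use A in auto)

lemma transpose_pow_mat:
  assumes A: "(A :: real mat) \<in> carrier_mat N N"
  shows "(A\<^sup>T) ^\<^sub>m k = (A ^\<^sub>m k)\<^sup>T"
proof (induction k)
  case 0
  then show ?case using A by simp
next
  case (Suc k)
  have P: "A ^\<^sub>m k \<in> carrier_mat N N" using A by (simp add: pow_carrier_mat)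
  \<comment> \<open>Powers grow by a factor on the right and transposition reverses products, so the
    new factor is first moved to the left.\<close>
  have "(A ^\<^sub>m Suc k)\<^sup>T = (A * A ^\<^sub>m k)\<^sup>T" using pow_mat_commute[OF A] by simp
  also have "\<dots> = (A ^\<^sub>m k)\<^sup>T * A\<^sup>T" using A P by (rule transpose_mult)
  finally show ?case using Suc by simp
qed

text \<open>A vector is orthogonal to the range of the controllability matrix iff it is orthogonal
  to every column. The columns are those of \<open>A^k B\<close> for \<open>k < N\<close>, and
  orthogonality to all columns of one such product means lying in the kernel of its transpose, which
  is the \<open>k\<close>-th observability block of the transposed pair.\<close>

lemma orth_compl_reach:
  assumes A: "A \<in> carrier_mat N N" and B: "B \<in> carrier_mat N m"
  shows "orth_compl N (reach A B) = unobs (B\<^sup>T) (A\<^sup>T)"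
proof -
  let ?M = "ctrb_mat A B" and ?P = "\<lambda>k. A ^\<^sub>m k * B"
  have M: "?M \<in> carrier_mat N (N * m)" using A B by (simp add: ctrb_mat_def)
  have P: "?P k \<in> carrier_mat N m" for k
    by (rule mult_carrier_mat[OF pow_carrier_mat[OF A] B])
  have tP: "B\<^sup>T * (A\<^sup>T) ^\<^sub>m k = (?P k)\<^sup>T" for k
    using transpose_pow_mat[OF A] transpose_mult[OF pow_carrier_mat[OF A] B] by simp
  \<comment> \<open>Column \<open>l\<close> of the \<open>k\<close>-th block sits at position
    \<open>k * m + l\<close>, matching the \<open>div\<close> and \<open>mod\<close> in
    \<open>ctrb_mat\<close>.\<close>
  have colM: "col ?M (k * m + l) = col (?P k) l" if "k < N" "l < m" for k l
  proof -
    have "k * m + l < Suc k * m" using that by simp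
    also have "\<dots> \<le> N * m" using that by (intro mult_le_mono1) simp
    finally have lt: "k * m + l < N * m" .
    have "(k * m + l) div m = k" "(k * m + l) mod m = l" using that by auto
    then show ?thesis using lt that A B P[of k] by (intro eq_vecI) (auto simp: ctrb_mat_def)
  qed
  have perp: "y \<in> orth_compl N (reach A B) \<longleftrightarrow> (\<forall>j<N * m. col ?M j \<bullet> y = 0)"
    if y: "y \<in> carrier_vec N" for y
  proof -
    have adj: "(?M\<^sup>T *\<^sub>v y) \<bullet> v = y \<bullet> (?M *\<^sub>v v)" if "v \<in> carrier_vec (N * m)" for v
      using transpose_vec_mult_scalar[OF M that y] .
    have T: "?M\<^sup>T *\<^sub>v y \<in> carrier_vec (N * m)" using M by (intro carrier_vecI) simp
    have "y \<in> orth_compl N (reach A B) \<longleftrightarrow> (\<forall>v\<in>carrier_vec (N * m). (?M\<^sup>T *\<^sub>v y) \<bullet> v = 0)"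
      using M y by (auto simp: orth_compl_iff reach_def adj)
    \<comment> \<open>Testing against \<open>v = ?M\<^sup>T *\<^sub>v y\<close> itself forces that
      vector to vanish.\<close>
    also have "\<dots> \<longleftrightarrow> ?M\<^sup>T *\<^sub>v y = 0\<^sub>v (N * m)"
      by (metis T scalar_prod_self_eq_0[OF T] scalar_prod_left_zero)
    also have "\<dots> \<longleftrightarrow> (\<forall>j<N * m. col ?M j \<bullet> y = 0)"
      using M by (auto simp: vec_eq_iff)
    finally show ?thesis .
  qed
  have ker: "y \<in> mat_kernel (B\<^sup>T * (A\<^sup>T) ^\<^sub>m k) \<longleftrightarrow> (\<forall>l<m. col (?P k) l \<bullet> y = 0)"
    if "y \<in> carrier_vec N" for y k
    using that P[of k] unfolding tP by (auto simp: mat_kernel_def vec_eq_iff)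
  have split: "(\<forall>j<N * m. col ?M j \<bullet> y = 0) \<longleftrightarrow> (\<forall>k<N. \<forall>l<m. col (?P k) l \<bullet> y = 0)" for y
  proof safe
    fix k l assume H: "\<forall>j<N * m. col ?M j \<bullet> y = 0" and kl: "k < N" "l < m"
    have "k * m + l < Suc k * m" using kl by simp
    also have "\<dots> \<le> N * m" using kl by (intro mult_le_mono1) simp
    finally show "col (?P k) l \<bullet> y = 0" using H colM[OF kl] by auto
  next
    fix j assume H: "\<forall>k<N. \<forall>l<m. col (?P k) l \<bullet> y = 0" and j: "j < N * m"
    \<comment> \<open>No column index exists when \<open>m = 0\<close>, so \<open>div\<close> and
      \<open>mod\<close> by \<open>m\<close> give a genuine block and offset.\<close>
    then have m: "0 < m" by (cases m) auto
    have "j div m < N" "j mod m < m" using j m by (auto simp: less_mult_imp_div_less)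
    then show "col ?M j \<bullet> y = 0" using H colM[of "j div m" "j mod m"] by simp
  qed
  show ?thesis
    using A perp ker split by (auto simp: unobs_def orth_compl_iff)
qed

section \<open>Duality of the structured subspaces\<close>

lemma blocks_atLeastAtMost: "blocks n {1..p} = {..<total p n}"
proof (induction p)
  case (Suc p)
  have "blocks n {1..Suc p} = blocks n {1..p} \<union> block n (Suc p)"
    by (simp add: blocks_def atLeastAtMostSuc_conv Un_commute)
  also have "\<dots> = {..<total p n} \<union> {total p n..<total p n + n (Suc p)}"
    using Suc by (simp add: block_def total_def atLeastLessThanSuc_atLeastAtMost)
  also have "\<dots> = {..<total (Suc p) n}" by (auto simp: total_def)
  finally show ?case .
qed (simp add: blocks_def total_def)

text \<open>The partial sum at the end of block \<open>i\<close> is at most the one at the start of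
  block \<open>j\<close>. The bound \<open>1 \<le> i\<close> excludes index 0, whose block would
  start at coordinate 0 just like block 1.\<close>

lemma block_disjoint:
  assumes "1 \<le> i" "i < j"
  shows "block n i \<inter> block n j = {}"
proof -
  have "(\<Sum>k\<in>{1..<i}. n k) + n i = (\<Sum>k\<in>{1..<Suc i}. n k)" using assms by simp
  also have "\<dots> \<le> (\<Sum>k\<in>{1..<j}. n k)" using assms by (intro sum_mono2) auto
  finally show ?thesis by (auto simp: block_def)
qed

lemma disjoint_family_on_block: "disjoint_family_on (block n) {1..p}"
  unfolding disjoint_family_on_def
  by (metis atLeastAtMost_iff block_disjoint inf_commute nat_neq_iff)

lemma blocks_subset: "S \<subseteq> {1..p} \<Longrightarrow> blocks n S \<subseteq> {..<total p n}"
  unfolding blocks_atLeastAtMost[symmetric] by (auto simp: blocks_def)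

lemma transpose_submatrix: "(submatrix G I J)\<^sup>T = submatrix (G\<^sup>T) J I"
  by (intro eq_matI) (auto simp: submatrix_def intro!: index_transpose_mat(1)[symmetric] pick_le)

lemma transpose_block_sub: "(block_sub n m G R S)\<^sup>T = block_sub m n (G\<^sup>T) S R"
  by (simp add: block_sub_def transpose_submatrix)

lemma block_sub_carrier:
  assumes "G \<in> carrier_mat (total p n) (total p m)" "R \<subseteq> {1..p}" "S \<subseteq> {1..p}"
  shows "block_sub n m G R S \<in> carrier_mat (card (blocks n R)) (card (blocks m S))"
proof -
  \<comment> \<open>The dimensions of \<open>submatrix\<close> count only selected indices within
    range; here every selected index is.\<close>
  have "{i. i < total p k \<and> i \<in> blocks k T} = blocks k T" if "T \<subseteq> {1..p}" for k T
    using blocks_subset[OF that, of k] by blast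
  then show ?thesis
    using assms by (intro carrier_matI) (simp_all add: block_sub_def dim_submatrix)
qed

section \<open>The dual system\<close>

lemma dual_system_simps [simp]:
  "np (dual_system \<Sigma>) = np \<Sigma>" "geq (dual_system \<Sigma>) = (geq \<Sigma>)\<inverse>"
  "xdim (dual_system \<Sigma>) = xdim \<Sigma>" "udim (dual_system \<Sigma>) = ydim \<Sigma>"
  "ydim (dual_system \<Sigma>) = udim \<Sigma>" "Am (dual_system \<Sigma>) = (Am \<Sigma>)\<^sup>T"
  "Bm (dual_system \<Sigma>) = (Cm \<Sigma>)\<^sup>T" "Cm (dual_system \<Sigma>) = (Bm \<Sigma>)\<^sup>T"
  "xtot (dual_system \<Sigma>) = xtot \<Sigma>" "poset_elems (dual_system \<Sigma>) = poset_elems \<Sigma>"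
  "down (dual_system \<Sigma>) = up \<Sigma>" "up (dual_system \<Sigma>) = down \<Sigma>"
  "local_space (dual_system \<Sigma>) = local_space \<Sigma>" "local_proj (dual_system \<Sigma>) = local_proj \<Sigma>"
  "direct_sum (dual_system \<Sigma>) = direct_sum \<Sigma>" "perp (dual_system \<Sigma>) = perp \<Sigma>"
  by (auto simp: dual_system_def xtot_def poset_elems_def down_def up_def local_space_def
      local_proj_def direct_sum_def perp_def fun_eq_iff)

text \<open>Results about a system and its dual, applied to the dual, thereby become results about
  the dual and the original system.\<close>

lemma dual_dual_system [simp]: "dual_system (dual_system \<Sigma>) = \<Sigma>"
  by (simp add: dual_system_def)

section \<open>Relative complements of the local reachability spaces of a causal system\<close>

context
  fixes \<Sigma> :: poset_system
  assumes causal: "poset_causal \<Sigma>"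
begin

lemma system_carrier:
  "Am \<Sigma> \<in> carrier_mat (xtot \<Sigma>) (xtot \<Sigma>)"
  "Bm \<Sigma> \<in> carrier_mat (xtot \<Sigma>) (total (np \<Sigma>) (udim \<Sigma>))"
  "Cm \<Sigma> \<in> carrier_mat (total (np \<Sigma>) (ydim \<Sigma>)) (xtot \<Sigma>)"
  using causal by (auto simp: poset_causal_def incidence_def xtot_def)

lemma up_subset: "up \<Sigma> j \<subseteq> {1..np \<Sigma>}" and down_subset: "down \<Sigma> j \<subseteq> {1..np \<Sigma>}"
  by (auto simp: up_def down_def poset_elems_def)

lemma finite_up: "finite (up \<Sigma> j)"
  by (rule finite_subset[OF up_subset]) simp

lemma self_in_down: "j \<in> poset_elems \<Sigma> \<Longrightarrow> j \<in> down \<Sigma> j"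
  using causal by (auto simp: poset_causal_def partial_order_on_def preorder_on_def refl_on_def
      down_def poset_elems_def)

lemma lin_subspace_local_space: "lin_subspace (xtot \<Sigma>) (local_space \<Sigma> j)"
  unfolding local_space_def by (rule lin_subspace_coord_space)

lemma local_proj_in: "local_proj \<Sigma> j x \<in> local_space \<Sigma> j"
  unfolding local_proj_def local_space_def by (rule coord_proj_in)

lemma lin_subspace_local_proj:
  "lin_subspace (xtot \<Sigma>) V \<Longrightarrow> lin_subspace (xtot \<Sigma>) (local_proj \<Sigma> j ` V)"
  unfolding local_proj_def by (rule lin_subspace_coord_proj)

lemma block_A_carrier:
  "S \<subseteq> {1..np \<Sigma>} \<Longrightarrow> block_sub (xdim \<Sigma>) (xdim \<Sigma>) (Am \<Sigma>) S S
     \<in> carrier_mat (card (blocks (xdim \<Sigma>) S)) (card (blocks (xdim \<Sigma>) S))"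
  using system_carrier by (intro block_sub_carrier) (auto simp: xtot_def)

lemma blocks_subset_xtot: "S \<subseteq> {1..np \<Sigma>} \<Longrightarrow> blocks (xdim \<Sigma>) S \<subseteq> {..<xtot \<Sigma>}"
  unfolding xtot_def by (rule blocks_subset)

lemma lin_subspace_R_at: "lin_subspace (xtot \<Sigma>) (R_at \<Sigma> i)"
  unfolding R_at_def
  by (intro lin_subspace_coord_embed lin_subspace_reach block_A_carrier blocks_subset_xtot down_subset)

lemma R_at_subset: "R_at \<Sigma> i \<subseteq> coord_space (xtot \<Sigma>) (blocks (xdim \<Sigma>) (down \<Sigma> i))"
  unfolding R_at_def using coord_embed_in by auto

lemma lin_subspace_R_glob: "lin_subspace (xtot \<Sigma>) (R_glob \<Sigma>)"
  unfolding R_glob_def by (rule lin_subspace_reach[OF system_carrier(1)])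

lemma N_glob_dual: "N_glob (dual_system \<Sigma>) = orth_compl (xtot \<Sigma>) (R_glob \<Sigma>)"
  unfolding N_glob_def R_glob_def by (simp add: orth_compl_reach[OF system_carrier(1,2)])

text \<open>The up-set of \<open>i\<close> in the dual poset is \<open>down \<Sigma> i\<close>, and
  the local matrices of the dual are transposes of those defining \<open>R_at\<close>. Kalman
  duality in the small space is then carried over by the embedding.\<close>

lemma N_at_dual:
  assumes i: "i \<in> poset_elems \<Sigma>"
  shows "N_at (dual_system \<Sigma>) i =
    coord_space (xtot \<Sigma>) (blocks (xdim \<Sigma>) (down \<Sigma> i)) \<inter> orth_compl (xtot \<Sigma>) (R_at \<Sigma> i)"
proof -
  let ?K = "blocks (xdim \<Sigma>) (down \<Sigma> i)"
  let ?A = "block_sub (xdim \<Sigma>) (xdim \<Sigma>) (Am \<Sigma>) (down \<Sigma> i) (down \<Sigma> i)"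
  let ?B = "block_sub (xdim \<Sigma>) (udim \<Sigma>) (Bm \<Sigma>) (down \<Sigma> i) {i}"
  have A: "?A \<in> carrier_mat (card ?K) (card ?K)" by (rule block_A_carrier[OF down_subset])
  have B: "?B \<in> carrier_mat (card ?K) (card (blocks (udim \<Sigma>) {i}))"
    using system_carrier(2) i down_subset
    by (intro block_sub_carrier) (auto simp: xtot_def poset_elems_def)
  have "N_at (dual_system \<Sigma>) i = coord_embed (xtot \<Sigma>) ?K ` unobs (?B\<^sup>T) (?A\<^sup>T)"
    by (simp add: N_at_def transpose_block_sub)
  also have "\<dots> = coord_embed (xtot \<Sigma>) ?K ` orth_compl (card ?K) (reach ?A ?B)"
    by (simp add: orth_compl_reach[OF A B])
  also have "\<dots> = coord_space (xtot \<Sigma>) ?K \<inter> orth_compl (xtot \<Sigma>) (R_at \<Sigma> i)"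
    unfolding R_at_def
    by (rule orth_compl_coord_embed[symmetric, OF blocks_subset_xtot[OF down_subset]
          lin_subspaceD(1)[OF lin_subspace_reach[OF A]]])
  finally show ?thesis .
qed

lemma local_space_subset:
  "j \<in> S \<Longrightarrow> local_space \<Sigma> j \<subseteq> coord_space (xtot \<Sigma>) (blocks (xdim \<Sigma>) S)"
  unfolding local_space_def blocks_def by (intro coord_space_mono) auto

lemma up_down: "i \<in> up \<Sigma> j \<Longrightarrow> j \<in> poset_elems \<Sigma> \<Longrightarrow> i \<in> poset_elems \<Sigma> \<and> j \<in> down \<Sigma> i"
  by (auto simp: up_def down_def)

lemma perp_R_tilde_comp:
  assumes "i \<in> poset_elems \<Sigma>" "j \<in> down \<Sigma> i"
  shows "local_space \<Sigma> j \<inter> perp \<Sigma> (R_tilde_comp \<Sigma> j i) = N_bar_comp (dual_system \<Sigma>) i j"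
proof -
  have "local_space \<Sigma> j \<inter> perp \<Sigma> (R_tilde_comp \<Sigma> j i) = local_space \<Sigma> j \<inter> perp \<Sigma> (R_at \<Sigma> i)"
    unfolding R_tilde_comp_def local_space_def local_proj_def perp_def
    by (rule orth_compl_coord_proj_image[OF lin_subspaceD(1)[OF lin_subspace_R_at]])
  also have "\<dots> = N_bar_comp (dual_system \<Sigma>) i j"
    using local_space_subset[OF assms(2)]
    by (auto simp: N_bar_comp_def perp_def N_at_dual[OF assms(1)])
  finally show ?thesis .
qed

text \<open>Projection-intersection duality with \<open>J\<close> the block of \<open>j\<close>,
  \<open>K\<close> the blocks of \<open>down \<Sigma> i\<close>, and \<open>M\<close> the local
  unobservable space of the dual.\<close>

lemma perp_R_bar_comp:
  assumes "i \<in> poset_elems \<Sigma>" "j \<in> down \<Sigma> i"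
  shows "local_space \<Sigma> j \<inter> perp \<Sigma> (R_bar_comp \<Sigma> j i) = N_tilde_comp (dual_system \<Sigma>) i j"
proof -
  have "block (xdim \<Sigma>) j \<subseteq> blocks (xdim \<Sigma>) (down \<Sigma> i)" using assms(2) by (auto simp: blocks_def)
  from orth_compl_Int_coord_space[OF lin_subspace_R_at R_at_subset this N_at_dual[OF assms(1)]]
  show ?thesis
    by (simp add: R_bar_comp_def N_tilde_comp_def perp_def local_space_def local_proj_def)
qed

lemma perp_R_circ_comp:
  "local_space \<Sigma> j \<inter> perp \<Sigma> (local_space \<Sigma> j \<inter> R_glob \<Sigma>) =
   local_proj \<Sigma> j ` N_glob (dual_system \<Sigma>)"
  unfolding local_space_def local_proj_def perp_def
proof (rule orth_compl_Int_coord_space[OF lin_subspace_R_glob])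
  \<comment> \<open>With \<open>K = UNIV\<close> the relative complement is the ordinary
    one.\<close>
  show "R_glob \<Sigma> \<subseteq> coord_space (xtot \<Sigma>) UNIV"
    using lin_subspaceD(1)[OF lin_subspace_R_glob] by (simp add: coord_space_eq_carrier)
  show "N_glob (dual_system \<Sigma>) = coord_space (xtot \<Sigma>) UNIV \<inter> orth_compl (xtot \<Sigma>) (R_glob \<Sigma>)"
    by (auto simp: N_glob_dual coord_space_eq_carrier orth_compl_iff)
qed simp

lemma lin_subspace_R_tilde_comp: "lin_subspace (xtot \<Sigma>) (R_tilde_comp \<Sigma> j i)"
  unfolding R_tilde_comp_def by (intro lin_subspace_local_proj lin_subspace_R_at)

lemma R_tilde_comp_subset: "R_tilde_comp \<Sigma> j i \<subseteq> local_space \<Sigma> j"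
  unfolding R_tilde_comp_def using local_proj_in by auto

lemma lin_subspace_R_bar_comp: "lin_subspace (xtot \<Sigma>) (R_bar_comp \<Sigma> j i)"
  unfolding R_bar_comp_def by (intro lin_subspace_Int lin_subspace_local_space lin_subspace_R_at)

lemma R_bar_comp_subset: "R_bar_comp \<Sigma> j i \<subseteq> local_space \<Sigma> j"
  by (auto simp: R_bar_comp_def)

text \<open>Reduces each global identity to one identity per local space, since the blocks partition
  the state coordinates.\<close>

lemma perp_direct_sum:
  assumes "\<And>j. j \<in> poset_elems \<Sigma> \<Longrightarrow> lin_subspace (xtot \<Sigma>) (V j)"
    "\<And>j. j \<in> poset_elems \<Sigma> \<Longrightarrow> V j \<subseteq> local_space \<Sigma> j"
    "\<And>j. j \<in> poset_elems \<Sigma> \<Longrightarrow> local_space \<Sigma> j \<inter> perp \<Sigma> (V j) = W j"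
  shows "perp \<Sigma> (direct_sum \<Sigma> V) = direct_sum \<Sigma> W"
proof -
  have "perp \<Sigma> (direct_sum \<Sigma> V) = direct_sum \<Sigma> (\<lambda>j. local_space \<Sigma> j \<inter> perp \<Sigma> (V j))"
    unfolding perp_def direct_sum_def local_space_def
  proof (rule orth_compl_direct_sum)
    show "{..<xtot \<Sigma>} \<subseteq> (\<Union>i\<in>poset_elems \<Sigma>. block (xdim \<Sigma>) i)"
      using blocks_atLeastAtMost[of "xdim \<Sigma>" "np \<Sigma>"]
      by (simp add: blocks_def xtot_def poset_elems_def)
    show "disjoint_family_on (block (xdim \<Sigma>)) (poset_elems \<Sigma>)"
      unfolding poset_elems_def by (rule disjoint_family_on_block)
  qed (use assms in \<open>auto simp: poset_elems_def local_space_def\<close>)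
  also have "\<dots> = direct_sum \<Sigma> W"
    unfolding direct_sum_def subspace_sum_def by (simp add: assms(3) cong: conj_cong)
  finally show ?thesis .
qed

lemma perp_local_sum:
  assumes j: "j \<in> poset_elems \<Sigma>"
    and V: "\<And>i. i \<in> up \<Sigma> j \<Longrightarrow> lin_subspace (xtot \<Sigma>) (V i)"
    and W: "\<And>i. i \<in> up \<Sigma> j \<Longrightarrow> local_space \<Sigma> j \<inter> perp \<Sigma> (V i) = W i"
  shows "local_space \<Sigma> j \<inter> perp \<Sigma> (subspace_sum (xtot \<Sigma>) (up \<Sigma> j) V) = (\<Inter>i\<in>up \<Sigma> j. W i)"
proof -
  \<comment> \<open>Reflexivity makes the index set nonempty, so the cut with the local space of
    \<open>j\<close> can be distributed over the intersection.\<close>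
  have "j \<in> up \<Sigma> j" using self_in_down[OF j] by (auto simp: up_def down_def)
  moreover have "x \<in> perp \<Sigma> (subspace_sum (xtot \<Sigma>) (up \<Sigma> j) V) \<longleftrightarrow>
      (\<forall>i\<in>up \<Sigma> j. x \<in> perp \<Sigma> (V i))" if "x \<in> local_space \<Sigma> j" for x
  proof -
    have "x \<in> carrier_vec (xtot \<Sigma>)"
      using that lin_subspaceD(1)[OF lin_subspace_local_space] by blast
    then show ?thesis
      unfolding perp_def using orth_compl_subspace_sum[where V=V, OF finite_up V] by simp
  qed
  ultimately show ?thesis using W by blast
qed

lemma local_sum_subset:
  assumes "\<And>i. V i \<subseteq> local_space \<Sigma> j"
  shows "subspace_sum (xtot \<Sigma>) (up \<Sigma> j) V \<subseteq> local_space \<Sigma> j"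
proof
  fix x assume x: "x \<in> subspace_sum (xtot \<Sigma>) (up \<Sigma> j) V"
  have car: "V i \<subseteq> carrier_vec (xtot \<Sigma>)" for i
    using assms coord_space_carrier unfolding local_space_def by blast
  obtain f where f: "\<And>i. i \<in> up \<Sigma> j \<Longrightarrow> f i \<in> V i" "x \<in> carrier_vec (xtot \<Sigma>)"
    "\<And>k. k < xtot \<Sigma> \<Longrightarrow> x $ k = (\<Sum>i\<in>up \<Sigma> j. f i $ k)"
    by (rule subspace_sumE[OF x finite_up car]) blast+
  have "f i \<in> local_space \<Sigma> j" if "i \<in> up \<Sigma> j" for i using f(1)[OF that] assms by blast
  then show "x \<in> local_space \<Sigma> j"
    using f(2,3) by (auto simp: local_space_def coord_space_def intro!: sum.neutral)
qed

section \<open>Complements of the global structured subspaces and the two equivalences\<close>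

lemma perp_R_tilde: "perp \<Sigma> (R_tilde \<Sigma>) = N_bar (dual_system \<Sigma>)"
  unfolding R_tilde_def N_bar_def dual_system_simps
proof (rule perp_direct_sum)
  fix j assume j: "j \<in> poset_elems \<Sigma>"
  show "lin_subspace (xtot \<Sigma>) (subspace_sum (xtot \<Sigma>) (up \<Sigma> j) (R_tilde_comp \<Sigma> j))"
    by (rule lin_subspace_subspace_sum[OF finite_up lin_subspace_R_tilde_comp])
  show "subspace_sum (xtot \<Sigma>) (up \<Sigma> j) (R_tilde_comp \<Sigma> j) \<subseteq> local_space \<Sigma> j"
    by (rule local_sum_subset[OF R_tilde_comp_subset])
  show "local_space \<Sigma> j \<inter> perp \<Sigma> (subspace_sum (xtot \<Sigma>) (up \<Sigma> j) (R_tilde_comp \<Sigma> j)) =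
      (\<Inter>i\<in>up \<Sigma> j. N_bar_comp (dual_system \<Sigma>) i j)"
    using up_down[OF _ j] perp_R_tilde_comp
    by (intro perp_local_sum[OF j lin_subspace_R_tilde_comp]) blast
qed

lemma perp_R_bar: "perp \<Sigma> (R_bar \<Sigma>) = N_tilde (dual_system \<Sigma>)"
  unfolding R_bar_def N_tilde_def dual_system_simps
proof (rule perp_direct_sum)
  fix j assume j: "j \<in> poset_elems \<Sigma>"
  show "lin_subspace (xtot \<Sigma>) (subspace_sum (xtot \<Sigma>) (up \<Sigma> j) (R_bar_comp \<Sigma> j))"
    by (rule lin_subspace_subspace_sum[OF finite_up lin_subspace_R_bar_comp])
  show "subspace_sum (xtot \<Sigma>) (up \<Sigma> j) (R_bar_comp \<Sigma> j) \<subseteq> local_space \<Sigma> j"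
    by (rule local_sum_subset[OF R_bar_comp_subset])
  show "local_space \<Sigma> j \<inter> perp \<Sigma> (subspace_sum (xtot \<Sigma>) (up \<Sigma> j) (R_bar_comp \<Sigma> j)) =
      (\<Inter>i\<in>up \<Sigma> j. N_tilde_comp (dual_system \<Sigma>) i j)"
    using up_down[OF _ j] perp_R_bar_comp
    by (intro perp_local_sum[OF j lin_subspace_R_bar_comp]) blast
qed

lemma perp_R_circ: "perp \<Sigma> (R_circ \<Sigma>) = N_circ (dual_system \<Sigma>)"
  unfolding R_circ_def N_circ_def dual_system_simps
  by (rule perp_direct_sum[OF _ _ perp_R_circ_comp])
    (auto intro: lin_subspace_Int lin_subspace_local_space lin_subspace_R_glob)

lemma lin_subspace_direct_sum:
  "(\<And>j. lin_subspace (xtot \<Sigma>) (V j)) \<Longrightarrow> lin_subspace (xtot \<Sigma>) (direct_sum \<Sigma> V)"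
  unfolding direct_sum_def by (rule lin_subspace_subspace_sum) (simp_all add: poset_elems_def)

lemma lin_subspace_R:
  shows "lin_subspace (xtot \<Sigma>) (R_bar \<Sigma>)" "lin_subspace (xtot \<Sigma>) (R_circ \<Sigma>)"
    "lin_subspace (xtot \<Sigma>) (R_tilde \<Sigma>)"
  unfolding R_bar_def R_circ_def R_tilde_def
  by (intro lin_subspace_direct_sum lin_subspace_subspace_sum finite_up lin_subspace_R_bar_comp
      lin_subspace_R_tilde_comp lin_subspace_Int lin_subspace_local_space lin_subspace_R_glob)+

text \<open>Double orthogonality inverts the three complement formulas. Instantiated at the dual
  system, it describes the dual's reachability subspaces by the original unobservability
  subspaces.\<close>

lemma perp_N_dual:
  shows "perp \<Sigma> (N_tilde (dual_system \<Sigma>)) = R_bar \<Sigma>"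
    "perp \<Sigma> (N_circ (dual_system \<Sigma>)) = R_circ \<Sigma>"
    "perp \<Sigma> (N_bar (dual_system \<Sigma>)) = R_tilde \<Sigma>"
  using lin_subspace_R[THEN orth_compl_orth_compl]
  by (simp_all add: perp_R_bar[symmetric] perp_R_circ[symmetric] perp_R_tilde[symmetric] perp_def)

lemma upstream_controllable_iff:
  "weakly_upstream_controllable \<Sigma> \<longleftrightarrow> weakly_downstream_observable (dual_system \<Sigma>)"
proof -
  \<comment> \<open>The state space is written as a coordinate space on all coordinates, so that the
    relative zero criterion applies.\<close>
  have "N_bar (dual_system \<Sigma>) = coord_space (xtot \<Sigma>) UNIV \<inter> orth_compl (xtot \<Sigma>) (R_tilde \<Sigma>)"
    by (auto simp: perp_R_tilde[symmetric] perp_def coord_space_eq_carrier orth_compl_iff)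
  then show ?thesis
    using orth_compl_within_coord_space_eq_zero_iff[OF lin_subspace_R(3), of UNIV]
      lin_subspaceD(1)[OF lin_subspace_R(3)]
    by (simp add: weakly_upstream_controllable_def weakly_downstream_observable_def
        state_space_def coord_space_eq_carrier)
qed

lemma locally_controllable_iff:
  "weakly_locally_controllable \<Sigma> \<longleftrightarrow> weakly_locally_observable (dual_system \<Sigma>)"
proof -
  have "R_tilde_comp \<Sigma> i i = local_space \<Sigma> i \<longleftrightarrow>
    N_bar_comp (dual_system \<Sigma>) i i = {0\<^sub>v (xtot \<Sigma>)}" if i: "i \<in> poset_elems \<Sigma>" for i
    \<comment> \<open>The diagonal pair \<open>i\<close>, \<open>i\<close> is admissible by
      reflexivity, and the zero criterion is taken relative to block \<open>i\<close>.\<close>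
    using perp_R_tilde_comp[OF i self_in_down[OF i]]
      orth_compl_within_coord_space_eq_zero_iff[OF lin_subspace_R_tilde_comp, of i i "block (xdim \<Sigma>) i"]
      R_tilde_comp_subset[of i i]
    by (simp add: perp_def local_space_def)
  then show ?thesis
    by (simp add: weakly_locally_controllable_def weakly_locally_observable_def)
qed

end

theorem theorem5p1:
  fixes \<Sigma> :: poset_system
  assumes "poset_causal \<Sigma>"
  shows "R_bar (dual_system \<Sigma>) = perp \<Sigma> (N_tilde \<Sigma>)
       \<and> R_circ (dual_system \<Sigma>) = perp \<Sigma> (N_circ \<Sigma>)
       \<and> R_tilde (dual_system \<Sigma>) = perp \<Sigma> (N_bar \<Sigma>)
       \<and> N_bar (dual_system \<Sigma>) = perp \<Sigma> (R_tilde \<Sigma>)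
       \<and> N_circ (dual_system \<Sigma>) = perp \<Sigma> (R_circ \<Sigma>)
       \<and> N_tilde (dual_system \<Sigma>) = perp \<Sigma> (R_bar \<Sigma>)
       \<and> (weakly_upstream_controllable \<Sigma> \<longleftrightarrow> weakly_downstream_observable (dual_system \<Sigma>))
       \<and> (weakly_locally_controllable \<Sigma> \<longleftrightarrow> weakly_locally_observable (dual_system \<Sigma>))"
  \<comment> \<open>The first three identities come from the dual system, whose dual simplifies back
    to \<open>\<Sigma>\<close>; the other three are the complement formulas for
    \<open>\<Sigma>\<close> itself.\<close>
  using perp_N_dual[OF poset_causal_dual[OF assms]] perp_R_bar[OF assms] perp_R_circ[OF assms]
    perp_R_tilde[OF assms] upstream_controllable_iff[OF assms] locally_controllable_iff[OF assms]
  by simp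

end
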